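(* A finite subset of $\mathbb{Z}^2$ is uniquely minimal if and only if it is congruent to either $B(2n,2n)$ or $B(n,n+1)$ for some $n\in\mathbb{N}$.
   Context: $X$ is the graph with vertex set $\mathbb{Z}^2$ in which $(x,y)$ and $(x',y')$ are adjacent iff $|x-x'|+|y-y'|=1$. For $A\subset\mathbb{Z}^2$, $\partial A=\{u\in\mathbb{Z}^2\setminus A:\ u \text{ adjacent to some } v\in A\}$. A finite set $A$ is minimal if $|\partial A|\le|\partial C|$ for all $C\subset\mathbb{Z}^2$ with $|C|=|A|$. Two sets are congruent if some graph automorphism of $X$ maps one onto the other. A set $A$ is uniquely minimal if it is minimal and every minimal set $C$ with $|C|=|A|$ is congruent to $A$. For $\alpha,\beta\in\mathbb{N}$, $B(\alpha,\beta)=\{(x,y)\in\mathbb{Z}^2: 0\le y-x\le\alpha,\ 0\le y+x\le\beta\}$.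
   Formalization: The finite subset is assumed nonempty: the empty set is vacuously uniquely minimal but is not congruent to any B(α,β), since each of these contains (0,0). *)

theory Defs
  imports Main
begin

type_synonym point = "int \<times> int"

definition adj :: "point \<Rightarrow> point \<Rightarrow> bool" where
  "adj u v \<longleftrightarrow> \<bar>fst u - fst v\<bar> + \<bar>snd u - snd v\<bar> = 1"

definition boundary :: "point set \<Rightarrow> point set" where
  "boundary A = {u. u \<notin> A \<and> (\<exists>v\<in>A. adj u v)}"

(* Finiteness of C must be explicit, since card is 0 on infinite sets. *)
definition minimal :: "point set \<Rightarrow> bool" where
  "minimal A \<longleftrightarrow> finite A \<and>
     (\<forall>C. finite C \<and> card C = card A \<longrightarrow> card (boundary A) \<le> card (boundary C))"

definition graph_automorphism :: "(point \<Rightarrow> point) \<Rightarrow> bool" where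
  "graph_automorphism f \<longleftrightarrow> bij f \<and> (\<forall>u v. adj (f u) (f v) \<longleftrightarrow> adj u v)"

definition congruent_sets :: "point set \<Rightarrow> point set \<Rightarrow> bool" where
  "congruent_sets A C \<longleftrightarrow> (\<exists>f. graph_automorphism f \<and> f ` A = C)"

definition uniquely_minimal :: "point set \<Rightarrow> bool" where
  "uniquely_minimal A \<longleftrightarrow> minimal A \<and>
     (\<forall>C. minimal C \<and> card C = card A \<longrightarrow> congruent_sets C A)"

definition Bset :: "nat \<Rightarrow> nat \<Rightarrow> point set" where
  "Bset a b = {(x, y). 0 \<le> y - x \<and> y - x \<le> int a \<and> 0 \<le> y + x \<and> y + x \<le> int b}"

end

theory Submission imports Defs
begin

text \<open>Rotate by 45 degrees: in the coordinates \<open>(y - x, y + x)\<close> the graph splits into two classes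
  (both coordinates even, both odd), and the neighbours of \<open>(u, v)\<close> are the points
  \<open>(u \<plusminus> 1, v \<plusminus> 1)\<close> of the other class. A class \<open>X\<close> meeting \<open>r\<close> rows and \<open>c\<close> columns has at
  least \<open>|X| + r + c + 1\<close> neighbours while \<open>|X| \<le> r c\<close>. Counting the boundary class by class, a
  nonempty set of size \<open>k\<close> with boundary of size \<open>S + 2\<close> satisfies \<open>8 k \<le> S\<^sup>2 + 4\<close>. For
  \<open>8 k = S\<^sup>2 + 4\<close> and \<open>8 k = S\<^sup>2 - 1\<close> every estimate is tight, so both classes are full products of
  arithmetic progressions that interleave to the box \<open>B(2n, 2n)\<close> or \<open>B(n, n + 1)\<close>. For all other
  sizes, boxes with part of one side removed give two minimal sets which differ in the imbalance
  between the two colour classes of the bipartite graph, an invariant of congruence.\<close>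

subsection \<open>Neighbourhoods in rotated coordinates\<close>

definition rot :: "point \<Rightarrow> point" where
  "rot w = (snd w - fst w, snd w + fst w)"

definition spread :: "int set \<Rightarrow> int set" where
  "spread P = (\<lambda>z. z + 1) ` P \<union> (\<lambda>z. z - 1) ` P"

definition hspread :: "point set \<Rightarrow> point set" where
  "hspread X = (\<lambda>(u, v). (u + 1, v)) ` X \<union> (\<lambda>(u, v). (u - 1, v)) ` X"

definition nbhd :: "point set \<Rightarrow> point set" where
  "nbhd X = {(u, v). \<exists>(a, b)\<in>X. \<bar>u - a\<bar> = 1 \<and> \<bar>v - b\<bar> = 1}"

text \<open>The points of one class only take coordinates of a single parity, so this is the
  analogue of an interval inside a class.\<close>

definition prog :: "int \<Rightarrow> nat \<Rightarrow> int set" where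
  "prog a n = {z. a \<le> z \<and> z < a + 2 * int n \<and> even (z - a)}"

lemma spread_iff: "z \<in> spread P \<longleftrightarrow> z - 1 \<in> P \<or> z + 1 \<in> P"
  by (force simp: spread_def image_iff)

lemma nbhd_iff:
  "(u, v) \<in> nbhd X \<longleftrightarrow>
    (u - 1, v - 1) \<in> X \<or> (u - 1, v + 1) \<in> X \<or> (u + 1, v - 1) \<in> X \<or> (u + 1, v + 1) \<in> X"
proof -
  have "\<bar>u - a\<bar> = 1 \<longleftrightarrow> a = u - 1 \<or> a = u + 1" for u a :: int by auto
  then show ?thesis unfolding nbhd_def by auto
qed

lemma nbhd_times: "nbhd (P \<times> Q) = spread P \<times> spread Q"
  by (auto simp: nbhd_iff spread_iff)

lemma nbhd_Un: "nbhd (X \<union> Y) = nbhd X \<union> nbhd Y"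
  by (auto simp: nbhd_iff)

lemma hspread_iff: "(u, v) \<in> hspread X \<longleftrightarrow> (u - 1, v) \<in> X \<or> (u + 1, v) \<in> X"
  by (force simp: hspread_def image_iff)

lemma finite_hspread: "finite X \<Longrightarrow> finite (hspread X)"
  by (simp add: hspread_def)

text \<open>A diagonal step is a horizontal step followed by a vertical one. Conjugating with
  \<open>prod.swap\<close> lets one counting lemma serve both directions.\<close>

lemma nbhd_conv_hspread: "nbhd X = prod.swap ` hspread (prod.swap ` hspread X)"
proof -
  have sw: "(u, v) \<in> prod.swap ` Z \<longleftrightarrow> (v, u) \<in> Z" for u v :: int and Z
    by force
  show ?thesis by (auto simp: nbhd_iff sw hspread_iff)
qed

lemma finite_nbhd: "finite X \<Longrightarrow> finite (nbhd X)"
  by (simp add: nbhd_conv_hspread finite_hspread)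

lemma finite_spread: "finite P \<Longrightarrow> finite (spread P)"
  by (simp add: spread_def)

text \<open>The right shift of \<open>X\<close> already has \<open>card X\<close> points, and at
  each occupied height the point to the left of the leftmost one is new.\<close>

lemma card_hspread_ge:
  assumes "finite X"
  shows "card X + card (snd ` X) \<le> card (hspread X)"
proof -
  define m where "m v = Min {u. (u, v) \<in> X}" for v
  have fin: "finite {u. (u, v) \<in> X}" for v
    by (rule finite_subset[of _ "fst ` X"]) (use assms in \<open>force+\<close>)
  have m_in: "(m v, v) \<in> X" if "v \<in> snd ` X" for v
    using Min_in[OF fin, of v] that unfolding m_def by force
  have m_le: "m v \<le> u" if "(u, v) \<in> X" for u v
    unfolding m_def using fin that by simp
  let ?I = "(\<lambda>(u, v). (u + 1, v)) ` X" and ?J = "(\<lambda>v. (m v - 1, v)) ` snd ` X"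
  have "card ?I = card X" by (rule card_image) (auto simp: inj_on_def)
  moreover have "card ?J = card (snd ` X)" by (rule card_image) (auto simp: inj_on_def)
  moreover have "?I \<inter> ?J = {}" using m_le by force
  moreover have "card (?I \<union> ?J) = card ?I + card ?J"
    by (rule card_Un_disjoint) (use assms calculation(3) in auto)
  moreover have "?I \<union> ?J \<subseteq> hspread X"
    using m_in by (force simp: hspread_def)
  then have "card (?I \<union> ?J) \<le> card (hspread X)"
    using assms by (intro card_mono finite_hspread)
  ultimately show ?thesis by simp
qed

lemma fst_hspread: "fst ` hspread X = spread (fst ` X)"
  by (force simp: hspread_def spread_def)

lemma card_insert_Min_shift:
  fixes P :: "int set"
  assumes "finite P" "P \<noteq> {}"
  shows "card (insert (Min P - 1) ((\<lambda>z. z + 1) ` P)) = card P + 1"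
proof -
  have "Min P - 1 \<noteq> z + 1" if "z \<in> P" for z
    using Min_le[OF assms(1) that] by linarith
  then have "Min P - 1 \<notin> (\<lambda>z. z + 1) ` P" by blast
  then show ?thesis using assms by (simp add: card_image)
qed

lemma insert_Min_shift_subset_spread:
  assumes "finite P" "P \<noteq> {}"
  shows "insert (Min P - 1) ((\<lambda>z. z + 1) ` P) \<subseteq> spread P"
  using assms by (auto simp: spread_def)

lemma card_spread_ge:
  assumes "finite P" "P \<noteq> {}"
  shows "card P + 1 \<le> card (spread P)"
  using card_mono[OF finite_spread insert_Min_shift_subset_spread] card_insert_Min_shift assms
  by metis

text \<open>The one-direction estimate is applied twice. The second pass counts the first
  coordinates of \<open>hspread X\<close>; they form the \<open>spread\<close> of those of
  \<open>X\<close> and so are at least one more, which is the source of the final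
  \<open>+ 1\<close>.\<close>

lemma card_nbhd_ge:
  assumes "finite X" "X \<noteq> {}"
  shows "card X + card (fst ` X) + card (snd ` X) + 1 \<le> card (nbhd X)"
proof -
  let ?H = "hspread X"
  have "card (nbhd X) = card (hspread (prod.swap ` ?H))"
    unfolding nbhd_conv_hspread by (rule card_image) simp
  moreover have "card (prod.swap ` ?H) = card ?H"
    by (rule card_image) simp
  moreover have "snd ` prod.swap ` ?H = spread (fst ` X)"
    by (simp add: image_image fst_hspread)
  moreover have "card ?H + card (spread (fst ` X)) \<le> card (hspread (prod.swap ` ?H))"
    using card_hspread_ge[of "prod.swap ` ?H"] calculation assms by (simp add: finite_hspread)
  ultimately show ?thesis
    using card_hspread_ge[of X] card_spread_ge[of "fst ` X"] assms by simp
qed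

section \<open>Progressions of difference 2 as extremal sets for \<open>spread\<close>\<close>

lemma prog_eq_image: "prog a n = (\<lambda>i. a + 2 * int i) ` {..<n}"
proof -
  have "z \<in> (\<lambda>i. a + 2 * int i) ` {..<n}" if z: "z \<in> prog a n" for z
  proof -
    from z have "even (z - a)" by (simp add: prog_def)
    then obtain j where "z - a = 2 * j" by (rule evenE)
    then have "z = a + 2 * j" by simp
    with z show ?thesis by (intro image_eqI[of _ _ "nat j"]) (auto simp: prog_def)
  qed
  then show ?thesis by (auto simp: prog_def)
qed

lemma finite_prog [simp]: "finite (prog a n)"
  by (simp add: prog_eq_image)

lemma card_prog [simp]: "card (prog a n) = n"
  unfolding prog_eq_image by (subst card_image) (auto simp: inj_on_def)

lemma spread_prog: "0 < n \<Longrightarrow> spread (prog a n) = prog (a - 1) (n + 1)"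
  by (auto simp: spread_iff prog_def)

text \<open>In the equality case \<open>spread P\<close> is just the right shift of \<open>P\<close>
  together with \<open>Min P - 1\<close>. Hence every element except the minimum has the number 2
  below it in \<open>P\<close>, and the descent ends exactly at the minimum.\<close>

lemma card_spread_eq_imp_prog:
  assumes "finite P" "P \<noteq> {}" "card (spread P) = card P + 1"
  shows "P = prog (Min P) (card P)"
proof -
  let ?m = "Min P"
  have eq: "insert (?m - 1) ((\<lambda>z. z + 1) ` P) = spread P"
    using card_subset_eq[OF finite_spread insert_Min_shift_subset_spread]
      card_insert_Min_shift[OF assms(1,2)] assms by simp
  have down: "z - 2 \<in> P" if "z \<in> P" "z \<noteq> ?m" for z
  proof -
    have "z - 1 \<in> spread P" using that by (simp add: spread_iff)
    with eq that show ?thesis by force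
  qed
  have run: "prog ?m (Suc i) \<subseteq> P" if "?m + 2 * int i \<in> P" for i
    using that
  proof (induction i)
    case 0
    have "prog ?m (Suc 0) = {?m}" by (simp add: prog_eq_image lessThan_Suc)
    with 0 show ?case by simp
  next
    case (Suc i)
    have "?m + 2 * int i \<in> P" using down[OF Suc.prems] by simp
    moreover have "prog ?m (Suc (Suc i)) = insert (?m + 2 * int (Suc i)) (prog ?m (Suc i))"
      by (simp add: prog_eq_image lessThan_Suc)
    ultimately show ?case using Suc by simp
  qed
  have par: "\<exists>i. z = ?m + 2 * int i" if "z \<in> P" for z
  proof -
    have "z \<in> P \<Longrightarrow> \<exists>i. z = ?m + 2 * int i"
    proof (induction "nat (z - ?m)" arbitrary: z rule: less_induct)
      case less
      have ge: "?m \<le> z" using less.prems assms(1) by simp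
      show ?case
      proof (cases "z = ?m")
        case True
        then show ?thesis by (intro exI[of _ 0]) simp
      next
        case False
        have d: "z - 2 \<in> P" using down less.prems False by blast
        have "\<exists>i. z - 2 = ?m + 2 * int i"
          using d ge False by (intro less.hyps) auto
        then obtain i where "z - 2 = ?m + 2 * int i" by blast
        then show ?thesis by (intro exI[of _ "Suc i"]) simp
      qed
    qed
    then show ?thesis using that .
  qed
  obtain i where i: "Max P = ?m + 2 * int i" using par Max_in assms by blast
  have "P = prog ?m (Suc i)"
  proof
    show "prog ?m (Suc i) \<subseteq> P" using run i Max_in assms by metis
    show "P \<subseteq> prog ?m (Suc i)"
    proof
      fix z assume "z \<in> P"
      with par obtain j where "z = ?m + 2 * int j" by blast
      moreover have "z \<le> Max P" using \<open>z \<in> P\<close> assms by simp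
      ultimately show "z \<in> prog ?m (Suc i)" using i by (simp add: prog_def)
    qed
  qed
  then show ?thesis by (metis card_prog)
qed

subsection \<open>Integer inequalities behind the isoperimetric bound\<close>

text \<open>Here \<open>x\<close> is the size of the only class, \<open>p\<close> its number of rows
  plus columns, and \<open>S + 2\<close> bounds the boundary. Squaring the last hypothesis gives
  \<open>8 * x - 4 + (x - 1)\<^sup>2 \<le> S\<^sup>2\<close>. The condition \<open>3 < S\<close>
  excludes the single point, where \<open>8 * x = S\<^sup>2 - 1\<close> does occur with
  \<open>S = 3\<close>.\<close>

lemma one_class_bound:
  fixes x p S :: int
  assumes "1 \<le> x" "2 \<le> p" "4 * x \<le> p\<^sup>2" "x + p - 1 \<le> S"
  shows "8 * x \<le> S\<^sup>2 + 4" "8 * x = S\<^sup>2 + 4 \<Longrightarrow> x = 1" "3 < S \<Longrightarrow> 8 * x \<noteq> S\<^sup>2 - 1"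
proof -
  have "(x + p - 1)\<^sup>2 \<le> S\<^sup>2" using assms by (intro power_mono) auto
  moreover have "0 \<le> (p - 2) * (x - 1)" using assms by simp
  ultimately have *: "x\<^sup>2 + 6 * x - 3 \<le> S\<^sup>2"
    using assms(3) by (simp add: power2_eq_square algebra_simps)
  have sq: "(x - 1)\<^sup>2 = x\<^sup>2 - 2 * x + 1" by (simp add: power2_eq_square algebra_simps)
  have "0 \<le> (x - 1)\<^sup>2" by simp
  then show "8 * x \<le> S\<^sup>2 + 4" using * sq by linarith
  show "x = 1" if "8 * x = S\<^sup>2 + 4"
  proof -
    have "(x - 1)\<^sup>2 \<le> 0" using * sq that by linarith
    then show ?thesis by simp
  qed
  show "8 * x \<noteq> S\<^sup>2 - 1" if "3 < S"
  proof
    assume e: "8 * x = S\<^sup>2 - 1"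
    have "x < 4"
    proof (rule ccontr)
      assume "\<not> x < 4"
      then have "4 * x \<le> x\<^sup>2" by (simp add: power2_eq_square)
      with * e \<open>\<not> x < 4\<close> show False by linarith
    qed
    then have x: "x = 1 \<or> x = 2 \<or> x = 3" using assms by linarith
    have "4\<^sup>2 \<le> S\<^sup>2" using that by (intro power_mono) auto
    moreover have "S \<noteq> 4"
    proof
      assume "S = 4"
      with e have "8 * x = 15" by simp
      then show False by presburger
    qed
    then have "5\<^sup>2 \<le> S\<^sup>2" using \<open>3 < S\<close> by (intro power_mono) auto
    ultimately have "x = 3" using e x by auto
    \<comment> \<open>Three points would go with \<open>S = 5\<close>, but their rows and columns
      number at least 4 together, which forces \<open>6 \<le> S\<close>.\<close>
    have "\<not> p \<le> 3"
    proof
      assume "p \<le> 3"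
      then have "p\<^sup>2 \<le> 3\<^sup>2" using assms by (intro power_mono) auto
      with \<open>x = 3\<close> assms show False by simp
    qed
    then have "6 \<le> S" using \<open>x = 3\<close> assms by linarith
    then have "6\<^sup>2 \<le> S\<^sup>2" by (intro power_mono) auto
    then show False using e \<open>x = 3\<close> by simp
  qed
qed

text \<open>The size bounds allow \<open>x + y\<close> to be large when \<open>p\<close> and
  \<open>q\<close> are far apart. The second bound on \<open>S\<close> penalises a surplus of the
  larger class and so rules out such shapes near the optimum.\<close>

lemma balanced_or_far_from_optimal:
  fixes x y p q S :: int
  assumes "y \<le> x" "2 \<le> p" "2 \<le> q" "4 * x \<le> p\<^sup>2" "4 * y \<le> q\<^sup>2"
    and S: "p + q \<le> S" "x - y + p - 1 \<le> S"
  shows "\<bar>p - q\<bar> \<le> 2 \<or> 8 * (x + y) \<le> S\<^sup>2 - 2"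
proof -
  have pq: "(p + q)\<^sup>2 \<le> S\<^sup>2" using assms by (intro power_mono) auto
  show ?thesis
  proof (cases "p \<le> x - y + 1")
    case True
    \<comment> \<open>In this case the surplus \<open>x - y\<close> is at least
      \<open>p - 1\<close>, and the bound \<open>T\<close> on \<open>S\<close> that it induces
      carries the estimate.\<close>
    define T where "T = x - y + p - 1"
    have T: "T \<le> S" "2 \<le> T" using True assms by (auto simp: T_def)
    have k: "8 * (x + y) \<le> 4 * p\<^sup>2 + 8 * p - 8 - 8 * T" using assms by (simp add: T_def)
    show ?thesis
    proof (cases "2 * p \<le> T + 1")
      case True
      then have "(2 * p + 2)\<^sup>2 \<le> (T + 3)\<^sup>2" using assms by (intro power_mono) auto
      moreover have "T\<^sup>2 \<le> S\<^sup>2" using T by (intro power_mono) auto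
      ultimately have "8 * (x + y) \<le> S\<^sup>2 - 2"
        using k T by (simp add: power2_eq_square algebra_simps)
      then show ?thesis ..
    next
      case False
      then have p: "p = x - y + 1" "T = 2 * p - 2" using \<open>p \<le> x - y + 1\<close> by (auto simp: T_def)
      show ?thesis
      proof (cases "T = S")
        case True
        then have q: "q \<le> p - 2" using S p by simp
        show ?thesis
        proof (cases "q = p - 2")
          case False
          then have "q\<^sup>2 \<le> (p - 3)\<^sup>2" using q assms by (intro power_mono) auto
          moreover have "S\<^sup>2 = (2 * p - 2)\<^sup>2" using True p by simp
          ultimately have "8 * (x + y) \<le> S\<^sup>2 - 2"
            using p q assms by (simp add: power2_eq_square algebra_simps)
          then show ?thesis ..
        qed simp
      next
        case False
        then have 1: "(2 * p - 1)\<^sup>2 \<le> S\<^sup>2" using T p assms by (intro power_mono) auto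
        have 2: "4\<^sup>2 \<le> S\<^sup>2" using assms by (intro power_mono) auto
        have "8 * (x + y) \<le> 4 * p\<^sup>2 - 8 * p + 8" using k p(2) by simp
        then have "8 * (x + y) \<le> S\<^sup>2 - 2"
          using 1 2 \<open>2 \<le> p\<close> by (cases "p = 2") (auto simp: power2_eq_square algebra_simps)
        then show ?thesis ..
      qed
    qed
  next
    case False
    consider "p \<ge> q + 3" | "q \<ge> p + 3" | "\<bar>p - q\<bar> \<le> 2" by linarith
    then show ?thesis
    proof cases
      case 1
      define d where "d = p - q"
      have d: "p = q + d" "3 \<le> d" using 1 by (auto simp: d_def)
      \<comment> \<open>This turns the linear bound \<open>x - y \<le> p - 2\<close> into
        \<open>4 * (q * d)\<close>, the mixed term of \<open>(2 * q + d)\<^sup>2\<close>.\<close>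
      have "0 \<le> (q - 2) * (d - 2)" using d assms by simp
      then have "8 * (x - y) \<le> 4 * (q * d)" using False d by (simp add: algebra_simps)
      moreover have "3 * 3 \<le> d * d" using d by (intro mult_mono) auto
      moreover have "(p + q)\<^sup>2 = 4 * q\<^sup>2 + 4 * (q * d) + d * d"
        unfolding d(1) by (simp add: power2_eq_square algebra_simps)
      ultimately have "8 * (x + y) \<le> (p + q)\<^sup>2 - 2"
        using assms(5) by simp
      then show ?thesis using pq by simp
    next
      case 2
      then have "(2 * p + 3)\<^sup>2 \<le> (p + q)\<^sup>2" using assms by (intro power_mono) auto
      then have "8 * (x + y) \<le> S\<^sup>2 - 2"
        using pq assms by (simp add: power2_eq_square algebra_simps)
      then show ?thesis ..
    qed simp
  qed
qed

text \<open>If \<open>p\<close> and \<open>q\<close> differ by at most 2, the identity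
  \<open>par\<close> bounds the size by \<open>S\<^sup>2 + 4\<close>, with equality only for
  difference 2. The value \<open>S\<^sup>2 - 1\<close> makes \<open>S = p + q\<close> odd, which
  leaves difference 1.\<close>

lemma two_class_bound:
  fixes x y p q S :: int
  assumes "2 \<le> p" "2 \<le> q" "4 * x \<le> p\<^sup>2" "4 * y \<le> q\<^sup>2"
    and S: "p + q \<le> S" "x - y + p - 1 \<le> S" "y - x + q - 1 \<le> S"
  shows "8 * (x + y) \<le> S\<^sup>2 + 4"
    and "8 * (x + y) = S\<^sup>2 + 4 \<Longrightarrow> S = p + q \<and> \<bar>p - q\<bar> = 2 \<and> 4 * x = p\<^sup>2 \<and> 4 * y = q\<^sup>2"
    and "8 * (x + y) = S\<^sup>2 - 1 \<Longrightarrow>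
      S = p + q \<and> \<bar>p - q\<bar> = 1 \<and> 8 * (x + y) = 2 * p\<^sup>2 + 2 * q\<^sup>2 - 2"
proof -
  have dich: "\<bar>p - q\<bar> \<le> 2 \<or> 8 * (x + y) \<le> S\<^sup>2 - 2"
  proof (cases "y \<le> x")
    case True
    then show ?thesis using balanced_or_far_from_optimal[of y x p q S] assms by auto
  next
    case False
    then show ?thesis using balanced_or_far_from_optimal[of x y q p S] assms
      by (auto simp: abs_minus_commute algebra_simps)
  qed
  have pq: "(p + q)\<^sup>2 \<le> S\<^sup>2" using assms by (intro power_mono) auto
  have par: "2 * p\<^sup>2 + 2 * q\<^sup>2 = (p + q)\<^sup>2 + (p - q)\<^sup>2"
    by (simp add: power2_eq_square algebra_simps)
  have diff: "(p - q)\<^sup>2 \<le> 4" if "\<bar>p - q\<bar> \<le> 2"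
    using power_mono[OF that, of 2] by simp
  show "8 * (x + y) \<le> S\<^sup>2 + 4"
  proof (cases "\<bar>p - q\<bar> \<le> 2")
    case True
    have "8 * (x + y) \<le> 2 * p\<^sup>2 + 2 * q\<^sup>2" using assms(3,4) by simp
    also have "\<dots> \<le> S\<^sup>2 + 4" unfolding par using pq diff[OF True] by (rule add_mono)
    finally show ?thesis .
  next
    case False
    then show ?thesis using dich by linarith
  qed
  show "S = p + q \<and> \<bar>p - q\<bar> = 2 \<and> 4 * x = p\<^sup>2 \<and> 4 * y = q\<^sup>2" if k: "8 * (x + y) = S\<^sup>2 + 4"
  proof -
    have "\<bar>p - q\<bar> \<le> 2" using dich k by linarith
    with diff have d: "(p - q)\<^sup>2 \<le> 4" by simp
    have eqs: "S\<^sup>2 = (p + q)\<^sup>2" "(p - q)\<^sup>2 = 2\<^sup>2" "4 * x = p\<^sup>2" "4 * y = q\<^sup>2"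
      using k d pq par assms(3,4) by simp_all
    have "S = p + q" using eqs(1) assms by (simp add: power2_eq_iff)
    moreover have "\<bar>p - q\<bar> = 2" using eqs(2) unfolding power2_eq_iff by auto
    ultimately show ?thesis using eqs by simp
  qed
  show "S = p + q \<and> \<bar>p - q\<bar> = 1 \<and> 8 * (x + y) = 2 * p\<^sup>2 + 2 * q\<^sup>2 - 2"
    if k: "8 * (x + y) = S\<^sup>2 - 1"
  proof -
    have d: "\<bar>p - q\<bar> \<le> 2" using dich k by linarith
    have Spq: "S = p + q"
    proof (rule ccontr)
      assume "S \<noteq> p + q"
      then have "(p + q + 1)\<^sup>2 \<le> S\<^sup>2" using assms by (intro power_mono) auto
      then show False using k par diff[OF d] assms
        by (simp add: power2_eq_square algebra_simps)
    qed
    have "S\<^sup>2 = 2 * (4 * (x + y)) + 1" using k by simp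
    then have "odd (S\<^sup>2)" by simp
    then have "odd S" by simp
    then have "\<bar>p - q\<bar> = 1" using d Spq by presburger
    moreover from this have "(p - q)\<^sup>2 = 1" by (metis power2_abs one_power2)
    ultimately show ?thesis using k par Spq by simp
  qed
qed

subsection \<open>Splitting a set into its two classes\<close>

lemma inj_rot: "inj rot"
  by (rule injI) (auto simp: rot_def prod_eq_iff)

lemma card_rot_image [simp]: "card (rot ` A) = card A"
  by (rule card_image) (rule inj_on_subset[OF inj_rot subset_UNIV])

lemma range_rot_iff: "(u, v) \<in> range rot \<longleftrightarrow> even (u + v)"
proof
  assume "even (u + v)"
  then have "rot ((v - u) div 2, (u + v) div 2) = (u, v)"
    by (auto simp: rot_def elim!: evenE) presburger+
  then show "(u, v) \<in> range rot" by (metis rangeI)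
qed (auto simp: rot_def)

lemma adj_iff_rot:
  "adj w z \<longleftrightarrow> \<bar>fst (rot w) - fst (rot z)\<bar> = 1 \<and> \<bar>snd (rot w) - snd (rot z)\<bar> = 1"
  unfolding adj_def rot_def fst_conv snd_conv by arith

lemma mem_nbhd_rot_image: "rot w \<in> nbhd (rot ` A) \<longleftrightarrow> (\<exists>z\<in>A. adj w z)"
  by (auto simp: nbhd_def adj_iff_rot case_prod_beta)

lemma nbhd_subset_range_rot:
  assumes "Z \<subseteq> range rot"
  shows "nbhd Z \<subseteq> range rot"
proof -
  have "(u, v) \<in> range rot" if "(u, v) \<in> nbhd Z" for u v
  proof -
    have "even (a + b)" if "(a, b) \<in> Z" for a b using that assms range_rot_iff by blast
    with that show ?thesis unfolding range_rot_iff nbhd_iff by fastforce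
  qed
  then show ?thesis by auto
qed

lemma rot_image_boundary: "rot ` boundary A = nbhd (rot ` A) - rot ` A"
proof -
  have mem: "rot w \<in> rot ` B \<longleftrightarrow> w \<in> B" for w B
    using inj_rot by (simp add: inj_image_mem_iff)
  have "rot w \<in> rot ` boundary A \<longleftrightarrow> rot w \<in> nbhd (rot ` A) - rot ` A" for w
    by (auto simp: mem mem_nbhd_rot_image boundary_def)
  moreover have "nbhd (rot ` A) \<subseteq> range rot" by (rule nbhd_subset_range_rot) blast
  ultimately show ?thesis by blast
qed

text \<open>A step changes the parity of both rotated coordinates, so the neighbours of one class
  can only meet the other class and the two pieces of the boundary are disjoint.\<close>

lemma card_boundary_classes:
  assumes "rot ` A = X \<union> Y" "finite A"
    and "\<And>w. w \<in> X \<Longrightarrow> even (fst w)" "\<And>w. w \<in> Y \<Longrightarrow> odd (fst w)"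
  shows "card (boundary A) = card (nbhd X - Y) + card (nbhd Y - X)"
proof -
  have X: "even u" if "(u, v) \<in> X" for u v using assms(3)[OF that] by simp
  have Y: "odd u" if "(u, v) \<in> Y" for u v using assms(4)[OF that] by simp
  have NX: "odd u" if "(u, v) \<in> nbhd X" for u v using that X unfolding nbhd_iff by fastforce
  have NY: "even u" if "(u, v) \<in> nbhd Y" for u v using that Y unfolding nbhd_iff by fastforce
  have disj: "nbhd X \<inter> X = {}" "nbhd Y \<inter> Y = {}" "nbhd X \<inter> nbhd Y = {}"
    by (auto dest: X Y NX NY)
  have "card (boundary A) = card (nbhd (X \<union> Y) - (X \<union> Y))"
    using card_rot_image[of "boundary A"] rot_image_boundary[of A] assms(1) by simp
  also have "nbhd (X \<union> Y) - (X \<union> Y) = (nbhd X - Y) \<union> (nbhd Y - X)"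
    unfolding nbhd_Un using disj by blast
  also have "card \<dots> = card (nbhd X - Y) + card (nbhd Y - X)"
  proof (rule card_Un_disjoint)
    have "finite (X \<union> Y)" using assms(1,2) by (metis finite_imageI)
    then show "finite (nbhd X - Y)" "finite (nbhd Y - X)" by (simp_all add: finite_nbhd)
    show "(nbhd X - Y) \<inter> (nbhd Y - X) = {}" using disj by blast
  qed
  finally show ?thesis .
qed

text \<open>On the image of \<open>rot\<close> both coordinates have the same parity, so the first
  one decides the class.\<close>

definition even_class :: "point set \<Rightarrow> point set" where
  "even_class A = {w \<in> rot ` A. even (fst w)}"

definition odd_class :: "point set \<Rightarrow> point set" where
  "odd_class A = {w \<in> rot ` A. odd (fst w)}"

lemma rot_image_classes: "rot ` A = even_class A \<union> odd_class A"
  by (auto simp: even_class_def odd_class_def)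

lemma finite_classes: "finite A \<Longrightarrow> finite (even_class A)" "finite A \<Longrightarrow> finite (odd_class A)"
  by (simp_all add: even_class_def odd_class_def)

lemma card_classes: "finite A \<Longrightarrow> card A = card (even_class A) + card (odd_class A)"
proof -
  assume "finite A"
  then have "card (even_class A \<union> odd_class A) = card (even_class A) + card (odd_class A)"
    by (intro card_Un_disjoint) (auto simp: finite_classes, auto simp: even_class_def odd_class_def)
  then show ?thesis by (metis card_rot_image rot_image_classes)
qed

lemma card_boundary_eq:
  "finite A \<Longrightarrow> card (boundary A) =
    card (nbhd (even_class A) - odd_class A) + card (nbhd (odd_class A) - even_class A)"
  by (rule card_boundary_classes[OF rot_image_classes]) (auto simp: even_class_def odd_class_def)

lemma card_le_card_projections:
  assumes "finite (X :: point set)"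
  shows "card X \<le> card (fst ` X) * card (snd ` X)"
proof -
  have "X \<subseteq> fst ` X \<times> snd ` X" by force
  then have "card X \<le> card (fst ` X \<times> snd ` X)" using assms by (intro card_mono) auto
  then show ?thesis by (simp add: card_cartesian_product)
qed

lemma four_mult_le_square_add: "4 * (r * c) \<le> (r + c)\<^sup>2" for r c :: int
proof -
  have "0 \<le> (r - c)\<^sup>2" by simp
  then show ?thesis by (simp add: power2_eq_square algebra_simps)
qed

lemma card_projections_pos:
  assumes "finite (X :: point set)" "X \<noteq> {}"
  shows "1 \<le> card (fst ` X)" "1 \<le> card (snd ` X)" "1 \<le> card X"
  using assms by (simp_all add: Suc_le_eq card_gt_0_iff)

lemma four_card_le:
  assumes "finite (X :: point set)"
  shows "4 * int (card X) \<le> (int (card (fst ` X)) + int (card (snd ` X)))\<^sup>2"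
proof -
  have "int (card X) \<le> int (card (fst ` X)) * int (card (snd ` X))"
    using card_le_card_projections[OF assms] by (metis of_nat_le_iff of_nat_mult)
  then show ?thesis
    using four_mult_le_square_add[of "int (card (fst ` X))" "int (card (snd ` X))"] by linarith
qed

lemma card_Diff_ge: "finite X \<Longrightarrow> finite Y \<Longrightarrow> int (card X) - int (card Y) \<le> int (card (X - Y))"
  using diff_card_le_card_Diff[of Y X] by linarith

section \<open>Class-wise bounds on the boundary and their equality cases\<close>

definition cross :: "point set \<Rightarrow> int" where
  "cross X = int (card (fst ` X)) + int (card (snd ` X))"

lemma cross_ge: "finite X \<Longrightarrow> X \<noteq> {} \<Longrightarrow> 2 \<le> cross X"
  using card_projections_pos[of X] by (simp add: cross_def)

lemma card_nbhd_Diff_ge: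
  assumes "finite X" "finite Y" "X \<noteq> {}"
  shows "int (card X) + cross X + 1 - int (card Y) \<le> int (card (nbhd X - Y))"
  using card_nbhd_ge[OF assms(1,3)] card_Diff_ge[of "nbhd X" Y] finite_nbhd assms
  by (simp add: cross_def)

text \<open>Equality in the size estimate makes \<open>X\<close> the product of its projections, and
  its neighbourhood is then the product of their spreads. Equality there makes both factors as small
  as possible, so both projections are progressions.\<close>

lemma tight_rectangle:
  assumes "finite X" "X \<noteq> {}" "card X = card (fst ` X) * card (snd ` X)"
    and "card (nbhd X) = card X + card (fst ` X) + card (snd ` X) + 1"
  obtains a b where "X = prog a (card (fst ` X)) \<times> prog b (card (snd ` X))"
proof -
  let ?P = "fst ` X" and ?Q = "snd ` X"
  have "X \<subseteq> ?P \<times> ?Q" by force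
  then have X: "X = ?P \<times> ?Q"
    using card_subset_eq[of "?P \<times> ?Q" X] assms by (simp add: card_cartesian_product)
  have fin: "finite ?P" "finite ?Q" "?P \<noteq> {}" "?Q \<noteq> {}" using assms by auto
  have "card (nbhd X) = card (spread ?P) * card (spread ?Q)"
    using arg_cong[OF X, of nbhd] by (metis card_cartesian_product nbhd_times)
  then have prod: "card (spread ?P) * card (spread ?Q) = (card ?P + 1) * (card ?Q + 1)"
    using assms by simp
  have ge: "card ?P + 1 \<le> card (spread ?P)" "card ?Q + 1 \<le> card (spread ?Q)"
    using card_spread_ge fin by auto
  have "card (spread ?P) = card ?P + 1"
  proof (rule ccontr)
    assume "card (spread ?P) \<noteq> card ?P + 1"
    with ge have "card ?P + 1 < card (spread ?P)" by simp
    then have "(card ?P + 1) * (card ?Q + 1) < card (spread ?P) * card (spread ?Q)"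
      using ge by (intro mult_less_le_imp_less) auto
    with prod show False by simp
  qed
  moreover have "card (spread ?Q) = card ?Q + 1"
    using prod unfolding calculation mult_cancel1 by simp
  ultimately have "?P = prog (Min ?P) (card ?P)" "?Q = prog (Min ?Q) (card ?Q)"
    using card_spread_eq_imp_prog fin by blast+
  then show thesis using that X by metis
qed

text \<open>\<open>S + 2\<close> is only an upper bound for the boundary, so that a hypothetical
  smaller boundary can be tested by inserting \<open>S - 1\<close>.\<close>

context
  fixes A X Y :: "point set" and S :: int
  assumes A: "finite A"
    and X: "X = even_class A" and Y: "Y = odd_class A"
    and bd: "int (card (boundary A)) \<le> S + 2"
begin

lemmas classes = rot_image_classes[of A, folded X Y] finite_classes[OF A, folded X Y]
  card_classes[OF A, folded X Y] card_boundary_eq[OF A, folded X Y]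

lemma single_class_cases:
  assumes "X = {} \<or> Y = {}" "A \<noteq> {}"
  shows "8 * int (card A) \<le> S\<^sup>2 + 4"
    and "8 * int (card A) = S\<^sup>2 + 4 \<Longrightarrow> card A = 1"
    and "3 < S \<Longrightarrow> 8 * int (card A) \<noteq> S\<^sup>2 - 1"
proof -
  define Z where "Z = X \<union> Y"
  have Z: "finite Z" "Z \<noteq> {}" "card Z = card A"
    using A assms(2) by (auto simp: Z_def simp flip: classes(1))
  have "card (nbhd Z) = card (boundary A)"
    using assms(1) classes(5) by (auto simp: Z_def nbhd_def)
  then have "int (card A) + cross Z - 1 \<le> S"
    using card_nbhd_ge[OF Z(1,2)] bd Z(3) by (simp add: cross_def)
  moreover have "4 * int (card A) \<le> (cross Z)\<^sup>2"
    using four_card_le[OF Z(1)] Z(3) by (simp add: cross_def)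
  moreover have "1 \<le> int (card A)" using card_projections_pos(3)[OF Z(1,2)] Z(3) by simp
  ultimately show "8 * int (card A) \<le> S\<^sup>2 + 4"
    "8 * int (card A) = S\<^sup>2 + 4 \<Longrightarrow> card A = 1"
    "3 < S \<Longrightarrow> 8 * int (card A) \<noteq> S\<^sup>2 - 1"
    using one_class_bound[of "int (card A)" "cross Z" S] cross_ge[OF Z(1,2)] by auto
qed

text \<open>Adding the estimates of the two classes cancels the sizes; keeping one estimate and
  dropping the nonnegative other term gives the remaining two bounds.\<close>

lemma both_classes_bounds:
  assumes "X \<noteq> {}" "Y \<noteq> {}"
  shows "cross X + cross Y \<le> S"
    "int (card X) - int (card Y) + cross X - 1 \<le> S"
    "int (card Y) - int (card X) + cross Y - 1 \<le> S"
  using card_nbhd_Diff_ge[of X Y] card_nbhd_Diff_ge[of Y X] classes(2,3) assms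
    classes(5) bd by auto

lemma both_classes_cases:
  assumes "X \<noteq> {}" "Y \<noteq> {}"
  shows "8 * int (card A) \<le> S\<^sup>2 + 4"
    and "8 * int (card A) = S\<^sup>2 + 4 \<Longrightarrow>
      S = cross X + cross Y \<and> \<bar>cross X - cross Y\<bar> = 2 \<and>
      4 * int (card X) = (cross X)\<^sup>2 \<and> 4 * int (card Y) = (cross Y)\<^sup>2"
    and "8 * int (card A) = S\<^sup>2 - 1 \<Longrightarrow>
      S = cross X + cross Y \<and> \<bar>cross X - cross Y\<bar> = 1 \<and>
      8 * int (card A) = 2 * (cross X)\<^sup>2 + 2 * (cross Y)\<^sup>2 - 2"
proof -
  have k: "int (card A) = int (card X) + int (card Y)" using classes(4) by simp
  have "4 * int (card X) \<le> (cross X)\<^sup>2" "4 * int (card Y) \<le> (cross Y)\<^sup>2"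
    using four_card_le classes(2,3) by (simp_all add: cross_def)
  then show "8 * int (card A) \<le> S\<^sup>2 + 4"
    and "8 * int (card A) = S\<^sup>2 + 4 \<Longrightarrow>
      S = cross X + cross Y \<and> \<bar>cross X - cross Y\<bar> = 2 \<and>
      4 * int (card X) = (cross X)\<^sup>2 \<and> 4 * int (card Y) = (cross Y)\<^sup>2"
    and "8 * int (card A) = S\<^sup>2 - 1 \<Longrightarrow>
      S = cross X + cross Y \<and> \<bar>cross X - cross Y\<bar> = 1 \<and>
      8 * int (card A) = 2 * (cross X)\<^sup>2 + 2 * (cross Y)\<^sup>2 - 2"
    unfolding k
    using two_class_bound[OF cross_ge cross_ge _ _ both_classes_bounds] classes(2,3) assms
    by blast+
qed

lemma isoperimetric_bound:
  assumes "A \<noteq> {}"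
  shows "8 * int (card A) \<le> S\<^sup>2 + 4"
  using single_class_cases(1) both_classes_cases(1) assms by blast

text \<open>No slack is left: both neighbourhood counts are exact, and each class must remove all
  its points from the neighbourhood of the other.\<close>

lemma tight_classes:
  assumes "X \<noteq> {}" "Y \<noteq> {}" "S = cross X + cross Y"
  shows "card (nbhd X) = card X + card (fst ` X) + card (snd ` X) + 1" "Y \<subseteq> nbhd X"
    "card (nbhd Y) = card Y + card (fst ` Y) + card (snd ` Y) + 1" "X \<subseteq> nbhd Y"
proof -
  have fin: "finite X" "finite Y" using classes(2,3) by auto
  have eq: "int (card (nbhd X - Y)) + int (card (nbhd Y - X)) \<le> cross X + cross Y + 2"
    using classes(5) bd assms(3) by simp
  have 1: "int (card (nbhd X - Y)) = int (card X) + cross X + 1 - int (card Y)"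
    "int (card (nbhd Y - X)) = int (card Y) + cross Y + 1 - int (card X)"
    using eq card_nbhd_Diff_ge[of X Y] card_nbhd_Diff_ge[of Y X] fin assms by auto
  have 2: "int (card (nbhd Z - W)) = int (card (nbhd Z)) - int (card (nbhd Z \<inter> W))"
    if "finite Z" for Z W
  proof -
    have "card (nbhd Z \<inter> W) \<le> card (nbhd Z)" using that by (intro card_mono) (auto simp: finite_nbhd)
    then show ?thesis using card_Diff_subset_Int[of "nbhd Z" W] that by (simp add: finite_nbhd of_nat_diff)
  qed
  have 3: "card (nbhd X \<inter> Y) \<le> card Y" "card (nbhd Y \<inter> X) \<le> card X"
    using fin by (auto intro: card_mono)
  have 4: "int (card X) + cross X + 1 \<le> int (card (nbhd X))" "int (card Y) + cross Y + 1 \<le> int (card (nbhd Y))"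
    using card_nbhd_ge fin assms by (fastforce simp: cross_def)+
  show "card (nbhd X) = card X + card (fst ` X) + card (snd ` X) + 1"
    "card (nbhd Y) = card Y + card (fst ` Y) + card (snd ` Y) + 1"
    using 1 2[of X Y] 2[of Y X] 3 4 fin by (auto simp: cross_def)
  have "card (nbhd X \<inter> Y) = card Y" "card (nbhd Y \<inter> X) = card X"
    using 1 2[of X Y] 2[of Y X] 3 4 fin by auto
  then show "Y \<subseteq> nbhd X" "X \<subseteq> nbhd Y"
    using fin card_subset_eq[of Y "nbhd X \<inter> Y"] card_subset_eq[of X "nbhd Y \<inter> X"] by auto
qed

end

subsection \<open>Congruence\<close>

lemma graph_automorphism_inv:
  assumes "graph_automorphism f"
  shows "graph_automorphism (inv f)"
proof -
  have "bij f" using assms by (simp add: graph_automorphism_def)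
  moreover have "adj (inv f u) (inv f v) \<longleftrightarrow> adj u v" for u v
    using assms \<open>bij f\<close> unfolding graph_automorphism_def by (metis bij_inv_eq_iff)
  ultimately show ?thesis by (simp add: graph_automorphism_def bij_imp_bij_inv)
qed

lemma congruent_sets_sym: "congruent_sets A C \<Longrightarrow> congruent_sets C A"
proof -
  assume "congruent_sets A C"
  then obtain f where f: "graph_automorphism f" "f ` A = C" by (auto simp: congruent_sets_def)
  then have "inv f ` C = A"
    by (auto simp: graph_automorphism_def image_inv_f_f bij_is_inj)
  with graph_automorphism_inv[OF f(1)] show ?thesis by (auto simp: congruent_sets_def)
qed

lemma congruent_sets_trans:
  assumes "congruent_sets A B" "congruent_sets B C"
  shows "congruent_sets A C"
proof -
  obtain f g where "graph_automorphism f" "f ` A = B" "graph_automorphism g" "g ` B = C"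
    using assms by (auto simp: congruent_sets_def)
  moreover from this have "graph_automorphism (g \<circ> f)"
    by (simp add: graph_automorphism_def bij_comp del: split_paired_All)
  ultimately show ?thesis
    unfolding congruent_sets_def by (intro exI[of _ "g \<circ> f"]) (auto simp: image_comp)
qed

lemma congruent_sets_card:
  assumes "congruent_sets A C"
  shows "card C = card A" "card (boundary C) = card (boundary A)" "finite C \<longleftrightarrow> finite A"
proof -
  obtain f where f: "bij f" "\<And>u v. adj (f u) (f v) \<longleftrightarrow> adj u v" and C: "C = f ` A"
    using assms by (auto simp: congruent_sets_def graph_automorphism_def)
  have inj: "inj_on f Z" for Z using f(1) by (auto simp: bij_def intro: inj_on_subset)
  show "card C = card A" "finite C \<longleftrightarrow> finite A"
    using inj by (simp_all add: C card_image finite_image_iff)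
  have "f u \<in> boundary C \<longleftrightarrow> u \<in> boundary A" for u
    using inj[of UNIV] by (simp add: C boundary_def f(2) inj_image_mem_iff)
  moreover have "boundary C \<subseteq> range f" using bij_is_surj[OF f(1)] by simp
  ultimately have "boundary C = f ` boundary A" by blast
  then show "card (boundary C) = card (boundary A)" using inj by (simp add: card_image)
qed

definition box :: "int \<Rightarrow> int \<Rightarrow> int \<Rightarrow> int \<Rightarrow> point set" where
  "box a b c d = {(x, y). a \<le> y - x \<and> y - x \<le> b \<and> c \<le> y + x \<and> y + x \<le> d}"

lemma Bset_eq_box: "Bset m n = box 0 (int m) 0 (int n)"
  by (simp add: Bset_def box_def)

lemma congruent_setsI:
  assumes "\<And>u v. adj (f u) (f v) \<longleftrightarrow> adj u v" "\<And>u. g (f u) = u" "\<And>u. f (g u) = u"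
    and "\<And>u. f u \<in> C \<longleftrightarrow> u \<in> A"
  shows "congruent_sets A C"
proof -
  have "bij f" by (rule o_bij[of g]) (use assms in \<open>auto simp: fun_eq_iff\<close>)
  moreover have "C \<subseteq> range f" using bij_is_surj[OF \<open>bij f\<close>] by simp
  then have "f ` A = C" using assms(4) by blast
  ultimately show ?thesis using assms(1) by (auto simp: congruent_sets_def graph_automorphism_def)
qed

text \<open>Translating by \<open>(s, t)\<close> moves the rotated coordinates by
  \<open>(t - s, t + s)\<close>, a vector with even coordinate sum, so the parity of
  \<open>a + c\<close> is the obstruction.\<close>

lemma congruent_box_translate:
  assumes "even (a + c)"
  shows "congruent_sets (box a b c d) (box 0 (b - a) 0 (d - c))"
proof -
  obtain t where t: "a + c = 2 * t" using assms by (rule evenE)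
  define s where "s = c - t"
  have ac: "a = t - s" "c = t + s" using t by (auto simp: s_def)
  show ?thesis unfolding ac
    by (rule congruent_setsI[of "\<lambda>(x, y). (x - s, y - t)" "\<lambda>(x, y). (x + s, y + t)"])
      (auto simp: adj_def box_def)
qed

lemma congruent_box_swap: "congruent_sets (box a b c d) (box c d a b)"
  by (rule congruent_setsI[of "\<lambda>(x, y). (- x, y)" "\<lambda>(x, y). (- x, y)"])
    (auto simp: adj_def box_def)

lemma congruent_box_flip: "congruent_sets (box a b c d) (box (- b) (- a) c d)"
  by (rule congruent_setsI[of "\<lambda>(x, y). (y, x)" "\<lambda>(x, y). (y, x)"])
    (auto simp: adj_def box_def)

text \<open>If \<open>a + c\<close> is odd, reflecting an interval of odd length difference corrects
  the parity. One of \<open>n\<close> and \<open>n + 1\<close> is odd, so one of the two intervals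
  can be reflected.\<close>

lemma congruent_box_Bset_consecutive:
  "congruent_sets (box a (a + int n) c (c + int n + 1)) (Bset n (n + 1))"
proof (cases "even (a + c)")
  case True
  then show ?thesis
    using congruent_box_translate[of a c "a + int n" "c + int n + 1"]
    by (simp add: Bset_eq_box algebra_simps)
next
  case False
  show ?thesis
  proof (cases "even n")
    case True
    have "congruent_sets (box a (a + int n) c (c + int n + 1))
        (box (- (c + int n + 1)) (- c) a (a + int n))"
      using congruent_sets_trans[OF congruent_box_swap congruent_box_flip] .
    then have "congruent_sets (box a (a + int n) c (c + int n + 1))
        (box a (a + int n) (- (c + int n + 1)) (- c))"
      using congruent_sets_trans[OF _ congruent_box_swap] by blast
    moreover have "even (a + - (c + int n + 1))" using True False by auto
    then have "congruent_sets (box a (a + int n) (- (c + int n + 1)) (- c)) (Bset n (n + 1))"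
      using congruent_box_translate[of a "- (c + int n + 1)" "a + int n" "- c"]
      by (simp add: Bset_eq_box algebra_simps)
    ultimately show ?thesis using congruent_sets_trans by blast
  next
    case odd: False
    have "even (- (a + int n) + c)" using odd False by auto
    then have "congruent_sets (box (- (a + int n)) (- a) c (c + int n + 1)) (Bset n (n + 1))"
      using congruent_box_translate[of "- (a + int n)" c "- a" "c + int n + 1"]
      by (simp add: Bset_eq_box algebra_simps)
    then show ?thesis using congruent_sets_trans[OF congruent_box_flip] by blast
  qed
qed

text \<open>The inclusions force the two starts, and likewise the two ends, to differ by exactly 1,
  so the progressions interleave to an interval of \<open>r + s\<close> integers. If one is longer,
  it supplies the lowest element.\<close>

lemma prog_interleaved:
  assumes "even a" "odd b" "0 < r" "0 < s"
    and "prog b s \<subseteq> spread (prog a r)" "prog a r \<subseteq> spread (prog b s)"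
  defines "m \<equiv> min a b"
  shows "even z \<Longrightarrow> z \<in> prog a r \<longleftrightarrow> m \<le> z \<and> z < m + int (r + s)"
    and "odd z \<Longrightarrow> z \<in> prog b s \<longleftrightarrow> m \<le> z \<and> z < m + int (r + s)"
    and "r = s + 1 \<Longrightarrow> m = a" "s = r + 1 \<Longrightarrow> m = b"
proof -
  have ends: "c \<in> prog c n" "c + 2 * int n - 2 \<in> prog c n" if "0 < n" for c n
    using that by (auto simp: prog_def)
  have "b \<in> prog (a - 1) (r + 1)" "b + 2 * int s - 2 \<in> prog (a - 1) (r + 1)"
    "a \<in> prog (b - 1) (s + 1)" "a + 2 * int r - 2 \<in> prog (b - 1) (s + 1)"
    using assms(3-6) ends by (auto simp: spread_prog)
  then have weak: "a - 1 \<le> b" "b - 1 \<le> a" "b + 2 * int s \<le> a + 2 * int r + 2"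
    "a + 2 * int r \<le> b + 2 * int s + 2"
    by (auto simp: prog_def)
  obtain i where i: "a = 2 * i" using assms(1) by (rule evenE)
  obtain j where j: "b = 2 * j + 1" using assms(2) by (rule oddE)
  have E: "2 * w \<in> prog a r \<longleftrightarrow> i \<le> w \<and> w < i + int r" for w
    by (auto simp: prog_def i)
  have O: "2 * w + 1 \<in> prog b s \<longleftrightarrow> j \<le> w \<and> w < j + int s" for w
    by (auto simp: prog_def j)
  consider "j = i" "m = 2 * i" "r = s \<or> r = s + 1" | "j = i - 1" "m = 2 * i - 1" "r = s \<or> s = r + 1"
  proof -
    have "j = i \<and> (r = s \<or> r = s + 1) \<or> j = i - 1 \<and> (r = s \<or> s = r + 1)"
      using weak unfolding i j by presburger
    then show ?thesis using that by (auto simp: m_def i j)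
  qed
  then have *: "(2 * w \<in> prog a r \<longleftrightarrow> m \<le> 2 * w \<and> 2 * w < m + int (r + s)) \<and>
      (2 * w + 1 \<in> prog b s \<longleftrightarrow> m \<le> 2 * w + 1 \<and> 2 * w + 1 < m + int (r + s)) \<and>
      (r = s + 1 \<longrightarrow> m = a) \<and> (s = r + 1 \<longrightarrow> m = b)" for w
    unfolding E O by cases (auto simp: i j)
  show "z \<in> prog a r \<longleftrightarrow> m \<le> z \<and> z < m + int (r + s)" if "even z"
    using that * by (elim evenE) simp
  show "z \<in> prog b s \<longleftrightarrow> m \<le> z \<and> z < m + int (r + s)" if "odd z"
    using that * by (elim oddE) simp
  show "r = s + 1 \<Longrightarrow> m = a" "s = r + 1 \<Longrightarrow> m = b" using * by blast+
qed

subsection \<open>Rigidity of optimal boxes\<close>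

text \<open>Everything rests on \<open>(r + c)\<^sup>2 = 4 * (r * c) + (r - c)\<^sup>2\<close>,
  where the last term is at least 1 when \<open>r + c\<close> is odd.\<close>

lemma near_square_factors:
  fixes k r c :: int
  assumes "k \<le> r * c"
  shows "4 * k \<le> (r + c)\<^sup>2" "4 * k = (r + c)\<^sup>2 \<Longrightarrow> k = r * c \<and> r = c"
    "odd (r + c) \<Longrightarrow> 4 * k \<le> (r + c)\<^sup>2 - 1"
    "4 * k = (r + c)\<^sup>2 - 1 \<Longrightarrow> odd (r + c) \<Longrightarrow> k = r * c \<and> \<bar>r - c\<bar> = 1"
proof -
  have sq: "(r + c)\<^sup>2 = 4 * (r * c) + (r - c)\<^sup>2"
    by (simp add: power2_eq_square algebra_simps)
  have nonneg: "0 \<le> (r - c)\<^sup>2" by simp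
  show "4 * k \<le> (r + c)\<^sup>2" using sq nonneg assms by linarith
  show "k = r * c \<and> r = c" if "4 * k = (r + c)\<^sup>2"
  proof -
    have "(r - c)\<^sup>2 = 0" "k = r * c" using that sq nonneg assms by linarith+
    then show ?thesis by simp
  qed
  have ge1: "1 \<le> (r - c)\<^sup>2" if "odd (r + c)"
  proof -
    have "r - c \<noteq> 0" using that by auto
    then have "0 < (r - c)\<^sup>2" by simp
    then show ?thesis by linarith
  qed
  then show "4 * k \<le> (r + c)\<^sup>2 - 1" if "odd (r + c)" using sq that assms by fastforce
  show "k = r * c \<and> \<bar>r - c\<bar> = 1" if "4 * k = (r + c)\<^sup>2 - 1" "odd (r + c)"
  proof -
    have "(r - c)\<^sup>2 = 1" "k = r * c" using that sq ge1[OF that(2)] assms by linarith+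
    then show ?thesis by (auto simp: power2_eq_1_iff)
  qed
qed

text \<open>Both classes are products of progressions, which interleave in each coordinate. For
  square classes whose sides differ by 1, the larger class supplies both minima \<open>a\<close> and
  \<open>c\<close>, so these have equal parity; this parity is what the later translation
  needs.\<close>

lemma tight_box:
  assumes A: "finite A" and XY: "X = even_class A" "Y = odd_class A"
    and bd: "int (card (boundary A)) \<le> cross X + cross Y + 2"
    and ne: "X \<noteq> {}" "Y \<noteq> {}"
    and full: "card X = card (fst ` X) * card (snd ` X)" "card Y = card (fst ` Y) * card (snd ` Y)"
  obtains a c where
    "A = box a (a + int (card (fst ` X) + card (fst ` Y)) - 1)
           c (c + int (card (snd ` X) + card (snd ` Y)) - 1)"
    "card (fst ` X) = card (snd ` X) \<and> card (fst ` Y) = card (snd ` Y) \<and>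
      \<bar>int (card (fst ` X)) - int (card (fst ` Y))\<bar> = 1 \<longrightarrow> even (a + c)"
proof -
  define r0 c0 r1 c1 where dims: "r0 = card (fst ` X)" "c0 = card (snd ` X)"
    "r1 = card (fst ` Y)" "c1 = card (snd ` Y)"
  have fin: "finite X" "finite Y" using finite_classes[OF A] XY by auto
  note tight = tight_classes[OF A XY bd ne refl]
  obtain a0 b0 where X: "X = prog a0 r0 \<times> prog b0 c0"
    using tight_rectangle[OF fin(1) ne(1) full(1) tight(1)] dims by metis
  obtain a1 b1 where Y: "Y = prog a1 r1 \<times> prog b1 c1"
    using tight_rectangle[OF fin(2) ne(2) full(2) tight(3)] dims by metis
  have pos: "0 < r0" "0 < c0" "0 < r1" "0 < c1"
    using card_projections_pos fin ne by (simp_all add: dims Suc_le_eq)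
  have lattice: "even (u + v)" if "(u, v) \<in> X \<union> Y" for u v
    using that rot_image_classes[of A] XY range_rot_iff[of u v] by blast
  have "(a0, b0) \<in> X" "(a1, b1) \<in> Y" using pos by (auto simp: X Y prog_def)
  then have par: "even a0" "even b0" "odd a1" "odd b1"
    using lattice[of a0 b0] lattice[of a1 b1] XY by (auto simp: even_class_def odd_class_def)
  have ne': "prog a n \<noteq> {}" if "0 < n" for a n using that by (auto simp: prog_eq_image lessThan_empty_iff)
  have sub: "prog a1 r1 \<subseteq> spread (prog a0 r0)" "prog a0 r0 \<subseteq> spread (prog a1 r1)"
    "prog b1 c1 \<subseteq> spread (prog b0 c0)" "prog b0 c0 \<subseteq> spread (prog b1 c1)"
    using tight(2,4) ne' pos unfolding X Y nbhd_times by (auto simp: times_subset_iff)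
  define a where "a = min a0 a1"
  define c where "c = min b0 b1"
  note ra = prog_interleaved[OF par(1,3) pos(1,3) sub(1,2), folded a_def]
  note rc = prog_interleaved[OF par(2,4) pos(2,4) sub(3,4), folded c_def]
  have "w \<in> A \<longleftrightarrow> rot w \<in> X \<union> Y" for w
    using rot_image_classes[of A] XY inj_rot by (metis inj_image_mem_iff)
  moreover have "rot (x, y) \<in> X \<union> Y \<longleftrightarrow> (x, y) \<in> box a (a + int (r0 + r1) - 1) c (c + int (c0 + c1) - 1)"
    for x y
  proof -
    have mem: "(y - x, y + x) \<in> X \<union> Y \<longleftrightarrow>
        (if even (y - x) then y - x \<in> prog a0 r0 \<and> y + x \<in> prog b0 c0
         else y - x \<in> prog a1 r1 \<and> y + x \<in> prog b1 c1)"
      using par by (auto simp: X Y prog_def)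
    have "even (y + x) \<longleftrightarrow> even (y - x)" by simp
    then show ?thesis
      using mem ra(1,2)[of "y - x"] rc(1,2)[of "y + x"] by (auto simp: rot_def box_def)
  qed
  ultimately have "A = box a (a + int (r0 + r1) - 1) c (c + int (c0 + c1) - 1)" by auto
  moreover have "even (a + c)" if "r0 = c0" "r1 = c1" "\<bar>int r0 - int r1\<bar> = 1"
  proof -
    have "r0 = r1 + 1 \<or> r1 = r0 + 1" using that by linarith
    then show ?thesis using ra(3,4) rc(3,4) par that by auto
  qed
  ultimately show thesis using that unfolding dims by blast
qed

text \<open>This is the extreme case \<open>8 * card A = S\<^sup>2 + 4\<close>: both classes are
  full squares whose sides differ by 1, or \<open>A\<close> is a single point and
  \<open>n = 0\<close>.\<close>

lemma optimal_square_congruent: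
  assumes A: "finite A" and k: "card A = (n + 1)\<^sup>2 + n\<^sup>2" and bd: "card (boundary A) \<le> 4 * n + 4"
  shows "congruent_sets A (Bset (2 * n) (2 * n))"
proof -
  define X Y S where defs: "X = even_class A" "Y = odd_class A" "S = 4 * int n + 2"
  have bd': "int (card (boundary A)) \<le> S + 2" using bd by (simp add: defs)
  have kS: "8 * int (card A) = S\<^sup>2 + 4" by (simp add: k defs power2_eq_square algebra_simps)
  have "A \<noteq> {}" using k by auto
  show ?thesis
  proof (cases "X = {} \<or> Y = {}")
    case True
    then have "card A = 1"
      using single_class_cases(2)[OF A defs(1,2) bd' _ \<open>A \<noteq> {}\<close> kS] by blast
    then obtain x y where xy: "A = {(x, y)}" by (metis card_1_singletonE surj_pair)
    then have "A = box (y - x) (y - x) (y + x) (y + x)" by (auto simp: box_def)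
    moreover have "n = 0" using k \<open>card A = 1\<close> by (cases n) (auto simp: power2_eq_square)
    ultimately show ?thesis
      using congruent_box_translate[of "y - x" "y + x" "y - x" "y + x"] by (simp add: Bset_eq_box)
  next
    case False
    then have ne: "X \<noteq> {}" "Y \<noteq> {}" by auto
    note eqs = both_classes_cases(2)[OF A defs(1,2) bd' ne kS]
    have fin: "finite X" "finite Y" using finite_classes[OF A] defs by auto
    have X: "int (card X) = int (card (fst ` X)) * int (card (snd ` X)) \<and> card (fst ` X) = card (snd ` X)"
      using near_square_factors(2)[of "int (card X)" "int (card (fst ` X))" "int (card (snd ` X))"]
        card_le_card_projections[OF fin(1)] eqs by (simp add: cross_def flip: of_nat_mult)
    have Y: "int (card Y) = int (card (fst ` Y)) * int (card (snd ` Y)) \<and> card (fst ` Y) = card (snd ` Y)"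
      using near_square_factors(2)[of "int (card Y)" "int (card (fst ` Y))" "int (card (snd ` Y))"]
        card_le_card_projections[OF fin(2)] eqs by (simp add: cross_def flip: of_nat_mult)
    have full: "card X = card (fst ` X) * card (snd ` X)" "card Y = card (fst ` Y) * card (snd ` Y)"
      using X Y by (simp_all flip: of_nat_mult)
    have bd'': "int (card (boundary A)) \<le> cross X + cross Y + 2" using bd' eqs by simp
    obtain a c where box: "A = box a (a + int (card (fst ` X) + card (fst ` Y)) - 1)
           c (c + int (card (snd ` X) + card (snd ` Y)) - 1)"
      and ev: "card (fst ` X) = card (snd ` X) \<and> card (fst ` Y) = card (snd ` Y) \<and>
      \<bar>int (card (fst ` X)) - int (card (fst ` Y))\<bar> = 1 \<longrightarrow> even (a + c)"
      by (rule tight_box[OF A defs(1,2) bd'' ne full])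
    have "cross X = 2 * int (card (fst ` X))" "cross Y = 2 * int (card (fst ` Y))"
      using X Y by (simp_all add: cross_def)
    then have "\<bar>int (card (fst ` X)) - int (card (fst ` Y))\<bar> = 1" using eqs by linarith
    with ev X Y have "even (a + c)" by blast
    moreover have "int (card (fst ` X) + card (fst ` Y)) = 2 * int n + 1"
      using eqs X Y by (simp add: cross_def defs)
    then have "A = box a (a + 2 * int n) c (c + 2 * int n)" using box X Y by simp
    ultimately show ?thesis
      using congruent_box_translate[of a c "a + 2 * int n" "c + 2 * int n"] by (simp add: Bset_eq_box)
  qed
qed

text \<open>This is the case \<open>8 * card A = S\<^sup>2 - 1\<close> with \<open>S\<close> odd.
  Exactly one class has an odd number of rows plus columns; its sides differ by 1 while the other
  class is a square, so the sides of the whole box differ by 1.\<close>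

lemma optimal_consecutive_congruent:
  assumes A: "finite A" and k: "2 * card A = (n + 1) * (n + 2)" and "0 < n"
    and bd: "card (boundary A) \<le> 2 * n + 5"
  shows "congruent_sets A (Bset n (n + 1))"
proof -
  define X Y S where defs: "X = even_class A" "Y = odd_class A" "S = 2 * int n + 3"
  have bd': "int (card (boundary A)) \<le> S + 2" using bd by (simp add: defs)
  have "2 * int (card A) = (int n + 1) * (int n + 2)"
    using arg_cong[OF k, of int] by (simp add: algebra_simps)
  then have kS: "8 * int (card A) = S\<^sup>2 - 1" by (simp add: defs power2_eq_square algebra_simps)
  have "A \<noteq> {}" using k by auto
  have "3 < S" using \<open>0 < n\<close> by (simp add: defs)
  have ne: "X \<noteq> {}" "Y \<noteq> {}"
    using single_class_cases(3)[OF A defs(1,2) bd' _ \<open>A \<noteq> {}\<close> \<open>3 < S\<close>] kS by blast+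
  note eqs = both_classes_cases(3)[OF A defs(1,2) bd' ne kS]
  have fin: "finite X" "finite Y" using finite_classes[OF A] defs by auto
  have kXY: "int (card A) = int (card X) + int (card Y)" using card_classes[OF A] defs by simp
  note leX = card_le_card_projections[OF fin(1), folded of_nat_le_iff[where 'a = int], unfolded of_nat_mult]
    and leY = card_le_card_projections[OF fin(2), folded of_nat_le_iff[where 'a = int], unfolded of_nat_mult]
  note nX = near_square_factors[OF leX, folded cross_def]
    and nY = near_square_factors[OF leY, folded cross_def]
  have "odd S" by (simp add: defs(3))
  then have "odd (cross X + cross Y)" using eqs by metis
  then consider "odd (cross X)" "even (cross Y)" | "even (cross X)" "odd (cross Y)" by auto
  then have dims: "int (card X) = int (card (fst ` X)) * int (card (snd ` X)) \<and>
      int (card Y) = int (card (fst ` Y)) * int (card (snd ` Y)) \<and>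
      \<bar>int (card (fst ` X) + card (fst ` Y)) - int (card (snd ` X) + card (snd ` Y))\<bar> = 1"
  proof cases
    case 1
    have "4 * int (card X) = (cross X)\<^sup>2 - 1" "4 * int (card Y) = (cross Y)\<^sup>2"
      using eqs kXY nX(3)[OF 1(1)] nY(1) by linarith+
    then show ?thesis using nX(4)[OF _ 1(1)] nY(2) by simp
  next
    case 2
    have "4 * int (card Y) = (cross Y)\<^sup>2 - 1" "4 * int (card X) = (cross X)\<^sup>2"
      using eqs kXY nY(3)[OF 2(2)] nX(1) by linarith+
    then show ?thesis using nY(4)[OF _ 2(2)] nX(2) by simp
  qed
  then have full: "card X = card (fst ` X) * card (snd ` X)" "card Y = card (fst ` Y) * card (snd ` Y)"
    by (simp_all flip: of_nat_mult)
  have bd'': "int (card (boundary A)) \<le> cross X + cross Y + 2" using bd' eqs by simp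
  obtain a c where box: "A = box a (a + int (card (fst ` X) + card (fst ` Y)) - 1)
         c (c + int (card (snd ` X) + card (snd ` Y)) - 1)"
    by (rule tight_box[OF A defs(1,2) bd'' ne full])
  have "int (card (fst ` X) + card (fst ` Y)) + int (card (snd ` X) + card (snd ` Y)) = 2 * int n + 3"
    using eqs by (simp add: cross_def defs)
  with dims consider
    "int (card (fst ` X) + card (fst ` Y)) = int n + 1" "int (card (snd ` X) + card (snd ` Y)) = int n + 2"
    | "int (card (fst ` X) + card (fst ` Y)) = int n + 2" "int (card (snd ` X) + card (snd ` Y)) = int n + 1"
    by linarith
  then show ?thesis
  proof cases
    case 1
    then have "A = box a (a + int n) c (c + int n + 1)" using box by (simp add: algebra_simps)
    then show ?thesis using congruent_box_Bset_consecutive by simp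
  next
    case 2
    then have "A = box a (a + int n + 1) c (c + int n)" using box by (simp add: algebra_simps)
    then show ?thesis
      using congruent_sets_trans[OF congruent_box_swap congruent_box_Bset_consecutive] by simp
  qed
qed

subsection \<open>Two optimal sets in the remaining sizes\<close>

definition discrepancy :: "point set \<Rightarrow> int" where
  "discrepancy A = \<bar>int (card {w \<in> A. even (fst w + snd w)}) - int (card {w \<in> A. odd (fst w + snd w)})\<bar>"

lemma adj_parity: "adj u v \<Longrightarrow> even (fst u + snd u) \<noteq> even (fst v + snd v)"
  unfolding adj_def by presburger

text \<open>Connectedness of the grid, in the form needed to propagate a property from the
  origin.\<close>

lemma adj_connected_induct:
  fixes P :: "point \<Rightarrow> bool"
  assumes "P (0, 0)" and step: "\<And>u v. adj u v \<Longrightarrow> P u \<Longrightarrow> P v"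
  shows "P w"
proof -
  have x: "P (x, 0)" for x
  proof (induction x rule: int_induct[of _ 0])
    case (step1 i)
    then show ?case using step[of "(i, 0)" "(i + 1, 0)"] by (simp add: adj_def)
  next
    case (step2 i)
    then show ?case using step[of "(i, 0)" "(i - 1, 0)"] by (simp add: adj_def)
  qed (rule assms(1))
  have "P (x, y)" for x y
  proof (induction y rule: int_induct[of _ 0])
    case (step1 i)
    then show ?case using step[of "(x, i)" "(x, i + 1)"] by (simp add: adj_def)
  next
    case (step2 i)
    then show ?case using step[of "(x, i)" "(x, i - 1)"] by (simp add: adj_def)
  qed (rule x)
  then show ?thesis by (cases w) simp
qed

text \<open>Adjacency flips the colour, so whether \<open>f\<close> preserves or exchanges colours
  is the same at every point. The absolute value in \<open>discrepancy\<close> absorbs an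
  exchange.\<close>

lemma congruent_sets_discrepancy:
  assumes "congruent_sets A C"
  shows "discrepancy C = discrepancy A"
proof -
  obtain f where "graph_automorphism f" and C: "C = f ` A"
    using assms by (auto simp: congruent_sets_def)
  then have f: "inj f" "\<And>u v. adj (f u) (f v) \<longleftrightarrow> adj u v"
    by (auto simp: graph_automorphism_def bij_is_inj)
  let ?e = "\<lambda>w :: point. even (fst w + snd w)"
  have const: "(?e (f w) = ?e w) = (?e (f (0, 0)) = ?e (0, 0))" for w
    by (rule adj_connected_induct[where w = w]) (use adj_parity f(2) in blast)+
  have card_f: "card {w \<in> C. Q w} = card {w \<in> A. Q (f w)}" for Q
  proof -
    have "{w \<in> C. Q w} = f ` {w \<in> A. Q (f w)}" by (auto simp: C)
    then show ?thesis using f(1) by (simp add: card_image inj_on_subset)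
  qed
  show ?thesis
  proof (cases "?e (f (0, 0)) = ?e (0, 0)")
    case True
    then have "?e (f w) = ?e w" for w using const by blast
    then show ?thesis by (simp add: discrepancy_def card_f del: even_add odd_add)
  next
    case False
    then have "?e (f w) = (\<not> ?e w)" for w using const by blast
    then show ?thesis by (simp add: discrepancy_def card_f del: even_add odd_add)
  qed
qed

lemma discrepancy_classes:
  "discrepancy A = \<bar>int (card (even_class A)) - int (card (odd_class A))\<bar>"
proof -
  have "even_class A = rot ` {w \<in> A. even (fst w + snd w)}"
    "odd_class A = rot ` {w \<in> A. odd (fst w + snd w)}"
    by (auto simp: even_class_def odd_class_def rot_def)
  then show ?thesis by (simp add: discrepancy_def)
qed

text \<open>Deleting an initial segment of an extreme row trades each deleted point for a boundary
  point beyond that row, so the boundary does not grow. The sign \<open>\<delta>\<close> selects whether the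
  corner at which the deletion starts belongs to the full box.\<close>

lemma truncated_box:
  fixes \<delta> :: int
  assumes \<delta>: "\<delta> = 1 \<and> c1 \<le> c0 \<and> c0 \<le> c1 + 1 \<or> \<delta> = -1 \<and> c0 \<le> c1 \<and> c1 \<le> c0 + 1"
    and r: "r1 \<le> r0" "r0 \<le> r1 + 1" "0 < r0" and t: "t \<le> c0"
  obtains A where "finite A" "card A + t = r0 * c0 + r1 * c1"
    "card (boundary A) \<le> r0 + r1 + c0 + c1 + 2"
    "discrepancy A = \<bar>int (r0 * c0) - int t - int (r1 * c1)\<bar>"
proof -
  define X where "X = prog 0 r0 \<times> prog 0 c0 - {0} \<times> prog 0 t"
  define Y where "Y = prog 1 r1 \<times> prog \<delta> c1"
  \<comment> \<open>A point of the removed segment at first coordinate \<open>-1\<close> has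
    neighbours in the full rectangle only among the \<open>t\<close> deleted points.\<close>
  define NX where "NX = prog (-1) (r0 + 1) \<times> prog (-1) (c0 + 1) - {-1} \<times> prog (-1) t"
  define NY where "NY = prog 0 (r1 + 1) \<times> prog (\<delta> - 1) (c1 + 1)"
  have fin: "finite X" "finite Y" "finite NX" "finite NY"
    by (simp_all add: X_def Y_def NX_def NY_def)
  have cX: "card X + t = r0 * c0"
  proof -
    have sub: "{0} \<times> prog 0 t \<subseteq> prog 0 r0 \<times> prog 0 c0"
      using r t by (auto simp: prog_def)
    then have "card ({0 :: int} \<times> prog 0 t) \<le> card (prog 0 r0 \<times> prog 0 c0)" by (intro card_mono) auto
    with sub show ?thesis by (simp add: X_def card_Diff_subset card_cartesian_product)
  qed
  have cNX: "card NX + t = (r0 + 1) * (c0 + 1)"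
  proof -
    have sub: "{-1} \<times> prog (-1) t \<subseteq> prog (-1) (r0 + 1) \<times> prog (-1) (c0 + 1)"
      using r t by (auto simp: prog_def)
    then have "card ({-1 :: int} \<times> prog (-1) t) \<le> card (prog (-1) (r0 + 1) \<times> prog (-1) (c0 + 1))"
      by (intro card_mono) auto
    with sub show ?thesis by (simp add: NX_def card_Diff_subset card_cartesian_product)
  qed
  have cY: "card Y = r1 * c1" "card NY = (r1 + 1) * (c1 + 1)"
    by (simp_all add: Y_def NY_def card_cartesian_product)
  have parX: "even u" "even v" if "(u, v) \<in> X" for u v using that by (auto simp: X_def prog_def)
  have parY: "odd u" "odd v" if "(u, v) \<in> Y" for u v using that \<delta> by (auto simp: Y_def prog_def)
  have "nbhd X \<subseteq> NX"
    by (auto simp: nbhd_iff X_def NX_def prog_def)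
  have "nbhd Y \<subseteq> NY"
    by (auto simp: nbhd_iff Y_def NY_def prog_def)
  have "X \<subseteq> NY" using \<delta> r by (auto simp: X_def NY_def prog_def)
  have "Y \<subseteq> NX" using \<delta> r by (auto simp: Y_def NX_def prog_def)
  define A where "A = rot -` (X \<union> Y)"
  have "X \<union> Y \<subseteq> range rot"
    using parX parY by (auto simp: range_rot_iff)
  then have img: "rot ` A = X \<union> Y" by (auto simp: A_def)
  have finA: "finite A"
    using fin inj_rot by (auto simp: A_def intro!: finite_vimageI)
  have cls: "even_class A = X" "odd_class A = Y"
    using parX parY by (auto simp: even_class_def odd_class_def img)
  show thesis
  proof (rule that[OF finA])
    show "card A + t = r0 * c0 + r1 * c1"
      using card_classes[OF finA] cls cX cY by simp
    show "discrepancy A = \<bar>int (r0 * c0) - int t - int (r1 * c1)\<bar>"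
      using cX cY by (simp add: discrepancy_classes cls flip: cX)
    have "card (nbhd X - Y) \<le> card (NX - Y)" "card (nbhd Y - X) \<le> card (NY - X)"
      using \<open>nbhd X \<subseteq> NX\<close> \<open>nbhd Y \<subseteq> NY\<close> fin by (auto intro!: card_mono)
    moreover have "card (NX - Y) + card Y = card NX" "card (NY - X) + card X = card NY"
      using \<open>Y \<subseteq> NX\<close> \<open>X \<subseteq> NY\<close> fin card_mono[of NX Y] card_mono[of NY X]
      by (simp_all add: card_Diff_subset)
    \<comment> \<open>The deletion lowers \<open>card NX\<close> by \<open>t\<close> but also leaves
      \<open>t\<close> more points in \<open>NY - X\<close>, so \<open>t\<close> cancels.\<close>
    ultimately show "card (boundary A) \<le> r0 + r1 + c0 + c1 + 2"
      using card_boundary_eq[OF finA] cls cX cNX cY by (simp add: algebra_simps)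
  qed
qed

section \<open>Minimality criteria and the classification by size\<close>

text \<open>The size is too large for the isoperimetric bound at \<open>S - 1\<close>, so no set of
  this size has a smaller boundary.\<close>

lemma minimal_if_small_boundary:
  fixes S :: int
  assumes "finite A" "int (card (boundary A)) \<le> S + 2" "(S - 1)\<^sup>2 + 4 < 8 * int (card A)"
  shows "minimal A"
  unfolding minimal_def
proof (intro conjI allI impI)
  fix C :: "point set" assume C: "finite C \<and> card C = card A"
  show "card (boundary A) \<le> card (boundary C)"
  proof (rule ccontr)
    assume "\<not> ?thesis"
    then have b: "int (card (boundary C)) \<le> (S - 1) + 2" using assms(2) by linarith
    have "0 \<le> (S - 1)\<^sup>2" by simp
    then have "0 < card C" using C assms(3) by linarith
    then have "C \<noteq> {}" by auto
    then have "8 * int (card C) \<le> (S - 1)\<^sup>2 + 4"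
      using isoperimetric_bound[OF _ refl refl b] C by blast
    with C assms(3) show False by simp
  qed
qed (rule assms(1))

lemma not_uniquely_minimal:
  fixes S :: int
  assumes "finite C" "finite D" "card C = card A" "card D = card A"
    and "int (card (boundary C)) \<le> S + 2" "int (card (boundary D)) \<le> S + 2"
    and "(S - 1)\<^sup>2 + 4 < 8 * int (card A)" and "discrepancy C \<noteq> discrepancy D"
  shows "\<not> uniquely_minimal A"
proof
  assume um: "uniquely_minimal A"
  have "minimal C" "minimal D"
    using minimal_if_small_boundary[of C S] minimal_if_small_boundary[of D S] assms by auto
  then have "congruent_sets C A" "congruent_sets D A"
    using um assms(3,4) by (auto simp: uniquely_minimal_def)
  then show False using congruent_sets_discrepancy assms(8) by metis
qed

text \<open>\<open>D\<close> is an explicit set attaining the bound. Rigidity makes it congruent to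
  \<open>B\<close>, so the size and boundary of \<open>B\<close> never have to be computed.\<close>

lemma rigid_size:
  fixes S :: int
  assumes D: "finite D" "int (card (boundary D)) \<le> S + 2" "(S - 1)\<^sup>2 + 4 < 8 * int (card D)"
    and rigid: "\<And>C. finite C \<Longrightarrow> card C = card D \<Longrightarrow> int (card (boundary C)) \<le> S + 2 \<Longrightarrow> congruent_sets C B"
  shows "congruent_sets A B \<Longrightarrow> uniquely_minimal A"
    and "uniquely_minimal A \<Longrightarrow> card A = card D \<Longrightarrow> congruent_sets A B"
proof -
  have DB: "congruent_sets D B" using rigid D by blast
  have minD: "minimal D" using minimal_if_small_boundary D by blast
  show "uniquely_minimal A" if "congruent_sets A B"
  proof -
    have DA: "congruent_sets D A" using DB that congruent_sets_sym congruent_sets_trans by blast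
    note inv = congruent_sets_card[OF DA]
    have "minimal A" using minD inv by (simp add: minimal_def)
    moreover have "congruent_sets C A" if "minimal C" "card C = card A" for C
    proof -
      have "card (boundary C) \<le> card (boundary D)" "finite C"
        using that inv D(1) by (auto simp: minimal_def)
      then have "congruent_sets C B" using rigid[of C] that(2) inv(1) D(2) by simp
      then show ?thesis using \<open>congruent_sets A B\<close> congruent_sets_sym congruent_sets_trans by blast
    qed
    ultimately show ?thesis by (simp add: uniquely_minimal_def)
  qed
  show "congruent_sets A B" if "uniquely_minimal A" "card A = card D"
    using that minD DB congruent_sets_sym congruent_sets_trans unfolding uniquely_minimal_def by metis
qed

lemma rigid_square:
  shows "congruent_sets A (Bset (2 * n) (2 * n)) \<Longrightarrow> uniquely_minimal A"
    and "uniquely_minimal A \<Longrightarrow> card A = (n + 1)\<^sup>2 + n\<^sup>2 \<Longrightarrow> congruent_sets A (Bset (2 * n) (2 * n))"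
proof -
  obtain D where D: "finite D" "card D = (n + 1)\<^sup>2 + n\<^sup>2" "card (boundary D) \<le> 4 * n + 4"
    by (rule truncated_box[of 1 n "n + 1" n "n + 1" 0]) (auto simp: power2_eq_square)
  have bd: "int (card (boundary D)) \<le> (4 * int n + 2) + 2" using D(3) by linarith
  have gap: "((4 * int n + 2) - 1)\<^sup>2 + 4 < 8 * int (card D)"
    by (simp add: D(2) power2_eq_square algebra_simps)
  have rigid: "congruent_sets C (Bset (2 * n) (2 * n))"
    if "finite C" "card C = card D" "int (card (boundary C)) \<le> (4 * int n + 2) + 2" for C
    using optimal_square_congruent[of C n] that D(2) by auto
  note rs = rigid_size[OF D(1) bd gap rigid]
  show "congruent_sets A (Bset (2 * n) (2 * n)) \<Longrightarrow> uniquely_minimal A" using rs(1) .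
  show "uniquely_minimal A \<Longrightarrow> card A = (n + 1)\<^sup>2 + n\<^sup>2 \<Longrightarrow> congruent_sets A (Bset (2 * n) (2 * n))"
    using rs(2) D(2) by simp
qed

lemma rigid_consecutive:
  assumes "0 < n"
  shows "congruent_sets A (Bset n (n + 1)) \<Longrightarrow> uniquely_minimal A"
    and "uniquely_minimal A \<Longrightarrow> 2 * card A = (n + 1) * (n + 2) \<Longrightarrow> congruent_sets A (Bset n (n + 1))"
proof -
  obtain D where D: "finite D" "2 * card D = (n + 1) * (n + 2)" "card (boundary D) \<le> 2 * n + 5"
  proof (cases "even n")
    case True
    then obtain s where n: "n = 2 * s" by (rule evenE)
    show thesis
      by (rule truncated_box[of 1 s "s + 1" "s + 1" "s + 1" 0])
        (use that in \<open>auto simp: n algebra_simps\<close>)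
  next
    case False
    then obtain s where n: "n = 2 * s + 1" by (rule oddE)
    show thesis
      by (rule truncated_box[of 1 "s + 1" "s + 2" "s + 1" "s + 1" 0])
        (use that in \<open>auto simp: n algebra_simps\<close>)
  qed
  have k: "2 * int (card D) = (int n + 1) * (int n + 2)"
    using arg_cong[OF D(2), of int] by (simp add: algebra_simps)
  have bd: "int (card (boundary D)) \<le> (2 * int n + 3) + 2" using D(3) by linarith
  have gap: "((2 * int n + 3) - 1)\<^sup>2 + 4 < 8 * int (card D)"
    using k assms by (simp add: power2_eq_square algebra_simps)
  have rigid: "congruent_sets C (Bset n (n + 1))"
    if "finite C" "card C = card D" "int (card (boundary C)) \<le> (2 * int n + 3) + 2" for C
    using optimal_consecutive_congruent[of C n] that D(2) assms by auto
  note rs = rigid_size[OF D(1) bd gap rigid]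
  show "congruent_sets A (Bset n (n + 1)) \<Longrightarrow> uniquely_minimal A" using rs(1) .
  show "uniquely_minimal A \<Longrightarrow> 2 * card A = (n + 1) * (n + 2) \<Longrightarrow> congruent_sets A (Bset n (n + 1))"
    using rs(2) D(2) by simp
qed

text \<open>\<open>C\<close> is cut from a box with sides \<open>2 * n\<close>, and \<open>D\<close>
  from one with sides \<open>2 * n - 1\<close> and \<open>2 * n + 1\<close>: equal area in each
  class sum and equal perimeter, but discrepancies \<open>t\<close> and
  \<open>2 * n - t\<close>.\<close>

lemma not_uniquely_minimal_even_square:
  assumes A: "finite A" "card A + t = 2 * n\<^sup>2" and t: "t < n"
  shows "\<not> uniquely_minimal A"
proof -
  obtain C where C: "finite C" "card C + t = 2 * n\<^sup>2" "card (boundary C) \<le> 4 * n + 2"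
    "discrepancy C = int t"
    by (rule truncated_box[of 1 n n n n t]) (use t in \<open>auto simp: power2_eq_square\<close>)
  obtain m where m: "n = m + 1" using t by (cases n) auto
  obtain D where D: "finite D" "card D + t = 2 * n\<^sup>2" "card (boundary D) \<le> 4 * n + 2"
    "discrepancy D = \<bar>2 * int n - int t\<bar>"
    by (rule truncated_box[of 1 n "n + 1" m n t])
      (use t in \<open>auto simp: m power2_eq_square algebra_simps\<close>)
  have k: "int (card A) = 2 * (int n)\<^sup>2 - int t"
    using arg_cong[OF A(2), of int] by simp
  have gap: "(4 * int n - 1)\<^sup>2 + 4 < 8 * int (card A)"
    using t by (simp add: k power2_eq_square algebra_simps)
  show ?thesis
    by (rule not_uniquely_minimal[where C = C and D = D and S = "4 * int n"])
      (use A C D t gap in auto)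
qed

text \<open>Both sets come from boxes with sides \<open>2 * n + 1\<close>, placed differently in the
  lattice. The box for \<open>D\<close> has its corner off the lattice and one point fewer, hence
  the truncation by \<open>s = t - 1\<close>.\<close>

lemma not_uniquely_minimal_odd_square:
  assumes A: "finite A" "card A + t = (n + 1)\<^sup>2 + n\<^sup>2" and t: "1 \<le> t" "t \<le> n"
  shows "\<not> uniquely_minimal A"
proof -
  obtain C where C: "finite C" "card C + t = (n + 1)\<^sup>2 + n\<^sup>2" "card (boundary C) \<le> 4 * n + 4"
    "discrepancy C = \<bar>2 * int n + 1 - int t\<bar>"
    by (rule truncated_box[of 1 n "n + 1" n "n + 1" t])
      (use t in \<open>auto simp: power2_eq_square algebra_simps\<close>)
  obtain s where s: "t = s + 1" using t by (cases t) auto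
  obtain D where D: "finite D" "card D + s = 2 * (n * (n + 1))" "card (boundary D) \<le> 4 * n + 4"
    "discrepancy D = int s"
    by (rule truncated_box[of "-1" "n + 1" n n "n + 1" s])
      (use t in \<open>auto simp: s power2_eq_square algebra_simps\<close>)
  have k: "int (card A) = (int n + 1)\<^sup>2 + (int n)\<^sup>2 - int t"
    using arg_cong[OF A(2), of int] by (simp add: algebra_simps)
  have gap: "((4 * int n + 2) - 1)\<^sup>2 + 4 < 8 * int (card A)"
    using t by (simp add: k power2_eq_square algebra_simps)
  have "card D = card A" using A(2) D(2) s by (simp add: power2_eq_square)
  then show ?thesis
    by (intro not_uniquely_minimal[where C = C and D = D and S = "4 * int n + 2"])
      (use A C D t s gap in auto)
qed

text \<open>Both sets come from a box with sides \<open>2 * r\<close> and \<open>2 * c + 1\<close>,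
  whose classes differ by \<open>r\<close> points. \<open>C\<close> loses \<open>t\<close> points of
  the larger class and \<open>D\<close> loses \<open>t\<close> of the smaller.\<close>

lemma not_uniquely_minimal_consecutive:
  assumes A: "finite A" "card A + t = r * (2 * c + 1)" and t: "1 \<le> t" "t < c"
    and r: "r = c \<or> r = c + 1"
  shows "\<not> uniquely_minimal A"
proof -
  have "0 < r" using r t by auto
  obtain C where C: "finite C" "card C + t = r * (2 * c + 1)" "card (boundary C) \<le> 2 * r + 2 * c + 3"
    "discrepancy C = \<bar>int r - int t\<bar>"
    by (rule truncated_box[of 1 c "c + 1" r r t])
      (use t \<open>0 < r\<close> in \<open>auto simp: algebra_simps\<close>)
  obtain D where D: "finite D" "card D + t = r * (2 * c + 1)" "card (boundary D) \<le> 2 * r + 2 * c + 3"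
    "discrepancy D = int r + int t"
    by (rule truncated_box[of "-1" "c + 1" c r r t])
      (use t \<open>0 < r\<close> in \<open>auto simp: algebra_simps\<close>)
  have k: "int (card A) = int r * (2 * int c + 1) - int t"
    using arg_cong[OF A(2), of int] by (simp add: algebra_simps)
  have gap: "((2 * int r + 2 * int c + 1) - 1)\<^sup>2 + 4 < 8 * int (card A)"
    using t r by (auto simp: k power2_eq_square algebra_simps)
  show ?thesis
    by (rule not_uniquely_minimal[where C = C and D = D and S = "2 * int r + 2 * int c + 1"])
      (use A C D t \<open>0 < r\<close> gap in auto)
qed

text \<open>The size lies between two consecutive triangular numbers. The upper one gives
  \<open>B(n, n + 1)\<close>; the middle of the range is \<open>2 * n\<^sup>2\<close> or
  \<open>(n + 1)\<^sup>2 + n\<^sup>2\<close>, and the other sizes fall short of the middle or upper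
  value by \<open>t\<close>.\<close>

lemma size_cases:
  fixes k :: nat
  assumes "0 < k"
  obtains n where "k = (n + 1)\<^sup>2 + n\<^sup>2"
    | n where "0 < n" "2 * k = (n + 1) * (n + 2)"
    | n t where "k + t = 2 * n\<^sup>2" "t < n"
    | n t where "k + t = (n + 1)\<^sup>2 + n\<^sup>2" "1 \<le> t" "t \<le> n"
    | r c t where "k + t = r * (2 * c + 1)" "1 \<le> t" "t < c" "r = c \<or> r = c + 1"
proof -
  define m where "m = (LEAST m. 2 * k \<le> m * (m + 1))"
  have "2 * k \<le> (2 * k) * (2 * k + 1)" by simp
  then have upper: "2 * k \<le> m * (m + 1)" unfolding m_def by (rule LeastI)
  then obtain l where l: "m = l + 1" using assms by (cases m) auto
  have lower: "l * (l + 1) < 2 * k"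
    using not_less_Least[of l "\<lambda>m. 2 * k \<le> m * (m + 1)"] l unfolding m_def by simp
  show thesis
  proof (cases "even m")
    case True
    then obtain n where n: "m = 2 * n" by (rule evenE)
    have up: "k \<le> 2 * n\<^sup>2 + n" using upper by (simp add: n power2_eq_square algebra_simps)
    obtain j where j: "n = j + 1" "l = 2 * j + 1" using l n by (cases n) auto
    have lo: "2 * n\<^sup>2 < k + n" using lower by (simp add: j power2_eq_square algebra_simps)
    consider "k \<le> 2 * n\<^sup>2" | "k = 2 * n\<^sup>2 + n" | "2 * n\<^sup>2 < k" "k < 2 * n\<^sup>2 + n"
      using up by linarith
    then show thesis
    proof cases
      case 1
      then show thesis using lo by (intro that(3)[of "2 * n\<^sup>2 - k" n]) auto
    next
      case 2
      then show thesis by (intro that(2)[of l]) (auto simp: j power2_eq_square algebra_simps)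
    next
      case 3
      then show thesis
        by (intro that(5)[of "2 * n\<^sup>2 + n - k" n n]) (auto simp: power2_eq_square algebra_simps)
    qed
  next
    case False
    then obtain n where n: "m = 2 * n + 1" by (rule oddE)
    have up: "k \<le> 2 * n\<^sup>2 + 3 * n + 1" using upper by (simp add: n power2_eq_square algebra_simps)
    have ln: "l = 2 * n" using l n by simp
    have lo: "2 * n\<^sup>2 + n < k" using lower by (simp add: ln power2_eq_square algebra_simps)
    have sq: "(n + 1)\<^sup>2 + n\<^sup>2 = 2 * n\<^sup>2 + 2 * n + 1" by (simp add: power2_eq_square)
    \<comment> \<open>The size 1 is caught by the first case with \<open>n = 0\<close>; the strict
      inequality in the last two cases forces \<open>0 < n\<close>.\<close>
    consider "k = 2 * n\<^sup>2 + 2 * n + 1" | "k < 2 * n\<^sup>2 + 2 * n + 1"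
      | "2 * n\<^sup>2 + 2 * n + 1 < k" "k = 2 * n\<^sup>2 + 3 * n + 1"
      | "2 * n\<^sup>2 + 2 * n + 1 < k" "k < 2 * n\<^sup>2 + 3 * n + 1"
      using up by linarith
    then show thesis
    proof cases
      case 1
      then show thesis using that(1)[of n] sq by simp
    next
      case 2
      then show thesis using lo sq by (intro that(4)[of "2 * n\<^sup>2 + 2 * n + 1 - k" n]) auto
    next
      case 3
      then show thesis by (intro that(2)[of l]) (auto simp: ln power2_eq_square algebra_simps)
    next
      case 4
      then show thesis
        by (intro that(5)[of "2 * n\<^sup>2 + 3 * n + 1 - k" "n + 1" n])
          (auto simp: power2_eq_square algebra_simps)
    qed
  qed
qed

text \<open>The empty set is excluded because it is trivially uniquely minimal, while every
  \<open>Bset\<close> contains the origin.\<close>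

theorem theorem8p8:
  fixes A :: "(int \<times> int) set"
  assumes "finite A" and "A \<noteq> {}"
  shows "uniquely_minimal A \<longleftrightarrow>
    (\<exists>n::nat. congruent_sets A (Bset (2 * n) (2 * n)) \<or> congruent_sets A (Bset n (n + 1)))"
proof
  assume um: "uniquely_minimal A"
  have "0 < card A" using assms by (simp add: card_gt_0_iff)
  then show "\<exists>n. congruent_sets A (Bset (2 * n) (2 * n)) \<or> congruent_sets A (Bset n (n + 1))"
  proof (cases rule: size_cases)
    case (1 n)
    then show ?thesis using rigid_square(2)[OF um] by blast
  next
    case (2 n)
    then show ?thesis using rigid_consecutive(2)[OF _ um] by blast
  next
    case (3 n t)
    then show ?thesis using not_uniquely_minimal_even_square[OF assms(1)] um by blast
  next
    case (4 n t)
    then show ?thesis using not_uniquely_minimal_odd_square[OF assms(1)] um by blast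
  next
    case (5 r c t)
    then show ?thesis using not_uniquely_minimal_consecutive[OF assms(1)] um by blast
  qed
next
  assume "\<exists>n. congruent_sets A (Bset (2 * n) (2 * n)) \<or> congruent_sets A (Bset n (n + 1))"
  then obtain n where n: "congruent_sets A (Bset (2 * n) (2 * n)) \<or> congruent_sets A (Bset n (n + 1))" ..
  show "uniquely_minimal A"
  proof (cases "n = 0")
    case True
    \<comment> \<open>When \<open>y - x = 0\<close> the sum \<open>y + x\<close> is even, so the
      value 1 is never attained. This covers \<open>n = 0\<close>, which
      \<open>rigid_consecutive\<close> leaves out.\<close>
    have "Bset 0 1 = Bset 0 0" by (auto simp: Bset_def)
    then have "congruent_sets A (Bset (2 * 0) (2 * 0))" using n True by simp
    then show ?thesis by (rule rigid_square(1))
  next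
    case False
    then show ?thesis using n rigid_square(1) rigid_consecutive(1) by blast
  qed
qed

end
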